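(* Let $(X,d)$ be a compact metric space and $f_{0,\infty}=\{f_n\}_{n=0}^{\infty}$ an equi-continuous sequence of continuous self-maps of $X$. Then the following are equivalent: $(X,f_{0,\infty})$ is chain mixing; $(\mathcal K(X),\bar f_{0,\infty})$ is chain mixing; $(\mathcal F^1(X),\tilde f_{0,\infty})$ is chain mixing.
   Context: Induced systems: $\mathcal K(X)$ is the set of nonempty compact subsets of $X$ with the Hausdorff metric $D_X$; $\bar f_{0,\infty}=\{\bar f_n\}$, $\bar f_n(A)=f_n(A)$. For upper semicontinuous $u:X\to[0,1]$ let $[u]_\alpha=\{x:u(x)\ge\alpha\}$ for $\alpha\in(0,1]$ and $[u]_0=\overline{\{x:u(x)>0\}}$. $\mathcal F^1(X)$ is the set of upper semicontinuous $u:X\to[0,1]$ with $[u]_\alpha\in\mathcal K(X)$ for all $\alpha\in[0,1]$, with metric $d_\infty(u,v)=\sup_{\alpha\in(0,1]}D_X([u]_\alpha,[v]_\alpha)$. $\tilde f_{0,\infty}=\{\tilde f_n\}$ where $\tilde f_n(u)(x)=\sup_{z\in f_n^{-1}(x)}u(z)$ if $f_n^{-1}(x)\ne\emptyset$, and $0$ otherwise. Chain notions, for a metric space $(Y,\rho)$ with a sequence of continuous self-maps $g_{0,\infty}=\{g_i\}_{i\ge0}$: a $\delta$-chain of length $m$ from $x$ to $y$ is a finite sequence $x=x_0,x_1,\dots,x_m=y$ with $\rho(g_i(x_i),x_{i+1})<\delta$ for $0\le i\le m-1$. $(Y,g_{0,\infty})$ is chain mixing if for every $\epsilon>0$ and all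 $x,y\in Y$ there is an integer $N\ge1$ such that for every $n\ge N$ there is an $\epsilon$-chain from $x$ to $y$ of length $n$. *)

theory Defs
  imports "HOL-Analysis.Analysis"
begin

text \<open>Spaces that are not whole types (hyperspaces, spaces of fuzzy sets) are given by a carrier
  and a distance function.  All points of a chain lie in the carrier, and the map applied
  at the \<open>i\<close>-th step is \<open>g i\<close>, so every chain starts at time 0.\<close>

definition is_chain ::
  "'y set \<Rightarrow> ('y \<Rightarrow> 'y \<Rightarrow> real) \<Rightarrow> (nat \<Rightarrow> 'y \<Rightarrow> 'y) \<Rightarrow> real \<Rightarrow> nat \<Rightarrow> 'y \<Rightarrow> 'y \<Rightarrow> (nat \<Rightarrow> 'y) \<Rightarrow> bool"
  where "is_chain Y \<rho> g \<delta> m x y c \<longleftrightarrow>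
    (\<forall>i\<le>m. c i \<in> Y) \<and> c 0 = x \<and> c m = y \<and> (\<forall>i<m. \<rho> (g i (c i)) (c (Suc i)) < \<delta>)"

definition chain_mixing ::
  "'y set \<Rightarrow> ('y \<Rightarrow> 'y \<Rightarrow> real) \<Rightarrow> (nat \<Rightarrow> 'y \<Rightarrow> 'y) \<Rightarrow> bool"
  where "chain_mixing Y \<rho> g \<longleftrightarrow>
    (\<forall>\<epsilon>>0. \<forall>x\<in>Y. \<forall>y\<in>Y. \<exists>N\<ge>1. \<forall>n\<ge>N. \<exists>c. is_chain Y \<rho> g \<epsilon> n x y c)"

definition equicontinuous_seq :: "(nat \<Rightarrow> 'a::metric_space \<Rightarrow> 'a) \<Rightarrow> bool"
  where "equicontinuous_seq f \<longleftrightarrow>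
    (\<forall>\<epsilon>>0. \<exists>\<delta>>0. \<forall>n x y. dist x y < \<delta> \<longrightarrow> dist (f n x) (f n y) < \<epsilon>)"

definition hyperspace :: "'a::metric_space set set"
  where "hyperspace = {A. compact A \<and> A \<noteq> {}}"

text \<open>The suprema are of nonempty bounded sets of reals whenever \<open>A\<close> and \<open>B\<close> are in
  \<open>hyperspace\<close>; for other arguments the value is unspecified.\<close>

definition hausdorff_dist :: "'a::metric_space set \<Rightarrow> 'a set \<Rightarrow> real"
  where "hausdorff_dist A B = max (SUP a\<in>A. infdist a B) (SUP b\<in>B. infdist b A)"

definition induced_map :: "('a \<Rightarrow> 'a) \<Rightarrow> 'a set \<Rightarrow> 'a set"
  where "induced_map h A = h ` A"

definition upper_semicontinuous :: "('a::topological_space \<Rightarrow> real) \<Rightarrow> bool"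
  where "upper_semicontinuous u \<longleftrightarrow> (\<forall>x c. u x < c \<longrightarrow> (\<forall>\<^sub>F y in nhds x. u y < c))"

definition level_set :: "('a::topological_space \<Rightarrow> real) \<Rightarrow> real \<Rightarrow> 'a set"
  where "level_set u \<alpha> = (if \<alpha> = 0 then closure {x. u x > 0} else {x. u x \<ge> \<alpha>})"

definition fuzzy_space :: "('a::metric_space \<Rightarrow> real) set"
  where "fuzzy_space = {u. (\<forall>x. 0 \<le> u x \<and> u x \<le> 1) \<and> upper_semicontinuous u \<and>
    (\<forall>\<alpha>\<in>{0..1}. level_set u \<alpha> \<in> hyperspace)}"

definition fuzzy_dist :: "('a::metric_space \<Rightarrow> real) \<Rightarrow> ('a \<Rightarrow> real) \<Rightarrow> real"
  where "fuzzy_dist u v = (SUP \<alpha>\<in>{0<..1}. hausdorff_dist (level_set u \<alpha>) (level_set v \<alpha>))"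

definition fuzzy_map :: "('a \<Rightarrow> 'a) \<Rightarrow> ('a \<Rightarrow> real) \<Rightarrow> 'a \<Rightarrow> real"
  where "fuzzy_map h u x = (if h -` {x} \<noteq> {} then SUP z\<in>h -` {x}. u z else 0)"

end

theory Submission
  imports Defs
begin

text \<open>The three properties are shown equivalent in a cycle.  A chain of sets between two singletons
  contains a chain of points, chosen backwards from its end.  A chain of fuzzy sets between two
  indicator functions yields a chain of sets by passing to the level sets at 1.  The essential step
  leads from points to fuzzy sets \<open>u\<close>, \<open>v\<close>: by compactness, chain mixing of \<open>X\<close> holds with a length
  bound \<open>N\<close> that is uniform in the end points.  For \<open>n \<ge> N\<close> the (non-strict) \<open>\<epsilon>\<close>-chains of length
  \<open>n\<close> form a compact set \<open>P\<close> of sequences, on which \<open>w c = min (u (c 0)) (v (c n))\<close> is upper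
  semicontinuous.  The fuzzy sets \<open>u\<^sub>k z = sup {w c | c \<in> P, c k = z}\<close> form the required chain: since
  suprema are attained, the level set of \<open>u\<^sub>k\<close> at \<open>\<alpha> > 0\<close> is exactly \<open>{c k | c \<in> P, w c \<ge> \<alpha>}\<close>, so
  each chain in \<open>P\<close> moves its \<open>k\<close>-th point to within \<open>\<epsilon>\<close> of its next one, in both directions.\<close>

section \<open>The Hausdorff distance\<close>

text \<open>The bound is non-strict because a supremum of distances below \<open>e\<close> can equal
  \<open>e\<close>.\<close>

lemma hausdorff_dist_le:
  assumes "A \<noteq> {}" "B \<noteq> {}"
    and "\<And>a. a \<in> A \<Longrightarrow> \<exists>b\<in>B. dist a b \<le> e"
    and "\<And>b. b \<in> B \<Longrightarrow> \<exists>a\<in>A. dist a b \<le> e"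
  shows "hausdorff_dist A B \<le> e"
proof -
  have "(SUP a\<in>A. infdist a B) \<le> e"
    using assms by (intro cSUP_least) (auto intro: infdist_le2)
  moreover have "(SUP b\<in>B. infdist b A) \<le> e"
    using assms by (intro cSUP_least) (auto intro: infdist_le2 simp: dist_commute)
  ultimately show ?thesis
    by (simp add: hausdorff_dist_def)
qed

text \<open>Compactness of \<open>B\<close> bounds the supremum, so it dominates
  \<open>infdist b A\<close>; an infimum strictly below \<open>e\<close> is undercut by an actual
  point. The direction from \<open>B\<close> back to \<open>A\<close> is the one that building
  chains backwards calls for.\<close>

lemma hausdorff_dist_less_imp_near:
  assumes "A \<in> hyperspace" "B \<in> hyperspace" "hausdorff_dist A B < e" "b \<in> B"
  shows "\<exists>a\<in>A. dist a b < e"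
proof -
  have A: "A \<noteq> {}" and B: "compact B"
    using assms by (auto simp: hyperspace_def)
  have "bdd_above ((\<lambda>b. infdist b A) ` B)"
    using B by (intro bounded_imp_bdd_above compact_imp_bounded compact_continuous_image
        continuous_intros)
  then have "infdist b A \<le> (SUP b\<in>B. infdist b A)"
    using assms(4) by (intro cSUP_upper)
  with assms(3) have "infdist b A < e"
    by (simp add: hausdorff_dist_def)
  then show ?thesis
    using A by (simp add: infdist_def cINF_less_iff dist_commute [of _ b])
qed

section \<open>Upper semicontinuity and suprema over fibres\<close>

lemma upper_semicontinuous_iff_closed:
  "upper_semicontinuous u \<longleftrightarrow> (\<forall>c. closed {x. c \<le> u x})"
proof -
  have "closed {x. c \<le> u x} \<longleftrightarrow> (\<forall>x. u x < c \<longrightarrow> (\<forall>\<^sub>F y in nhds x. u y < c))" for c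
  proof -
    have "closed {x. c \<le> u x} \<longleftrightarrow> open {x. u x < c}"
      by (simp add: closed_def Collect_neg_eq [symmetric] not_le)
    also have "\<dots> \<longleftrightarrow> (\<forall>x. u x < c \<longrightarrow> (\<exists>S. open S \<and> x \<in> S \<and> (\<forall>y\<in>S. u y < c)))"
      by (subst open_subopen) (simp add: subset_iff Ball_def)
    finally show ?thesis
      by (simp add: eventually_nhds)
  qed
  then show ?thesis
    unfolding upper_semicontinuous_def by blast
qed

text \<open>Without a maximum, the open sets \<open>{x. u x < u y}\<close> with \<open>y\<close> in
  \<open>S\<close> would cover \<open>S\<close>. In a finite subcover, the index with the largest
  value is itself left uncovered.\<close>

lemma upper_semicontinuous_attains_sup:
  assumes u: "upper_semicontinuous u" and S: "compact S" "S \<noteq> {}"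
  shows "\<exists>x\<in>S. \<forall>y\<in>S. u y \<le> u x"
proof (rule ccontr)
  assume "\<not> ?thesis"
  then have *: "\<forall>x\<in>S. \<exists>y\<in>S. u x < u y"
    by (auto simp: not_le)
  have "open {x. u x < c}" for c
  proof -
    have "{x. u x < c} = - {x. c \<le> u x}"
      by auto
    then show ?thesis
      using u by (simp add: upper_semicontinuous_iff_closed open_closed)
  qed
  moreover have "S \<subseteq> (\<Union>y\<in>S. {x. u x < u y})"
    using * by auto
  ultimately obtain D where D: "D \<subseteq> S" "finite D" "S \<subseteq> (\<Union>y\<in>D. {x. u x < u y})"
    by (rule compactE_image [OF S(1)])
  have "D \<noteq> {}"
    using D(3) S(2) by auto
  then have "Max (u ` D) \<in> u ` D"
    using D(2) by (intro Max_in) auto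
  then obtain m where m: "m \<in> D" "Max (u ` D) = u m"
    by (rule imageE)
  then have "m \<in> (\<Union>y\<in>D. {x. u x < u y})"
    using D(1,3) by (meson subsetD)
  then obtain y where y: "y \<in> D" "u m < u y"
    by auto
  then have "u y \<le> Max (u ` D)"
    using D(2) by (intro Max_ge) auto
  with y m show False
    by simp
qed

text \<open>The formula of \<^const>\<open>fuzzy_map\<close>, for maps between different types.\<close>

definition push_sup :: "('b \<Rightarrow> 'a) \<Rightarrow> ('b \<Rightarrow> real) \<Rightarrow> 'a \<Rightarrow> real"
  where "push_sup h w x = (if h -` {x} \<noteq> {} then SUP z\<in>h -` {x}. w z else 0)"

lemma fuzzy_map_eq_push_sup: "fuzzy_map h = push_sup h"
  by (intro ext) (simp add: fuzzy_map_def push_sup_def)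

text \<open>Fibres of a continuous map into a T1 space are closed, hence compact here, so
  \<open>w\<close> has a maximum on each nonempty fibre.\<close>

lemma push_sup_attained:
  fixes h :: "'b::topological_space \<Rightarrow> 'a::t1_space"
  assumes "compact (UNIV :: 'b set)" "continuous_on UNIV h" "upper_semicontinuous w"
    and "h -` {x} \<noteq> {}"
  obtains z where "h z = x" "push_sup h w x = w z" "\<And>z'. h z' = x \<Longrightarrow> w z' \<le> w z"
proof -
  have "closed (h -` {x})"
    using assms(2) by (intro closed_vimage) auto
  then have "compact (h -` {x})"
    using compact_Int_closed [OF assms(1)] by auto
  then obtain z where z: "z \<in> h -` {x}" "\<forall>y\<in>h -` {x}. w y \<le> w z"
    using upper_semicontinuous_attains_sup [OF assms(3) _ assms(4)] by auto
  then have "(SUP z\<in>h -` {x}. w z) = w z"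
    by (intro cSup_eq_maximum) auto
  with assms(4) have "push_sup h w x = w z"
    by (simp add: push_sup_def)
  moreover have "h z = x" and "\<And>z'. h z' = x \<Longrightarrow> w z' \<le> w z"
    using z by auto
  ultimately show thesis
    using that by metis
qed

text \<open>An attained supremum of at least \<alpha> has a witness in the fibre with value at least
  \<alpha>, which gives equality with the image.\<close>

lemma push_sup_superlevel:
  fixes h :: "'b::topological_space \<Rightarrow> 'a::t1_space"
  assumes "compact (UNIV :: 'b set)" "continuous_on UNIV h" "upper_semicontinuous w" "0 < \<alpha>"
  shows "{x. \<alpha> \<le> push_sup h w x} = h ` {z. \<alpha> \<le> w z}"
proof (intro equalityI subsetI)
  fix x assume x: "x \<in> {x. \<alpha> \<le> push_sup h w x}"
  \<comment> \<open>On an empty fibre the default value 0 would lie below \<alpha>.\<close>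
  with \<open>0 < \<alpha>\<close> have "h -` {x} \<noteq> {}"
    by (auto simp: push_sup_def split: if_splits)
  then obtain z where "h z = x" "push_sup h w x = w z"
    using push_sup_attained [OF assms(1-3)] by metis
  with x show "x \<in> h ` {z. \<alpha> \<le> w z}"
    by auto
next
  fix x assume "x \<in> h ` {z. \<alpha> \<le> w z}"
  then obtain z where z: "h z = x" "\<alpha> \<le> w z"
    by auto
  then have "h -` {x} \<noteq> {}"
    by auto
  then obtain z' where z': "push_sup h w x = w z'" "\<And>z''. h z'' = x \<Longrightarrow> w z'' \<le> w z'"
    using push_sup_attained [OF assms(1-3)] by metis
  show "x \<in> {x. \<alpha> \<le> push_sup h w x}"
    using z z'(1) z'(2) [of z] by simp
qed

section \<open>Fuzzy sets on a compact space\<close>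

text \<open>The point \<open>x1\<close> lies in every level set, including the closure at 0, so none
  is empty. Superlevel sets outside the range (0,1] are the whole space or empty.\<close>

lemma fuzzy_spaceI:
  fixes u :: "'a::metric_space \<Rightarrow> real"
  assumes X: "compact (UNIV :: 'a set)" and u: "\<And>x. 0 \<le> u x" "\<And>x. u x \<le> 1"
    and "\<And>\<alpha>. 0 < \<alpha> \<Longrightarrow> \<alpha> \<le> 1 \<Longrightarrow> closed {x. \<alpha> \<le> u x}"
    and x1: "u x1 = 1"
  shows "u \<in> fuzzy_space"
proof -
  have cl: "closed {x. \<alpha> \<le> u x}" for \<alpha>
  proof -
    consider "\<alpha> \<le> 0" | "1 < \<alpha>" | "0 < \<alpha>" "\<alpha> \<le> 1"
      by linarith
    then show ?thesis
    proof cases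
      case 1
      then have "{x. \<alpha> \<le> u x} = UNIV"
        using u by (auto intro: order_trans)
      then show ?thesis
        by simp
    next
      case 2
      then have "{x. \<alpha> \<le> u x} = {}"
        using u(2) by (auto simp: not_le intro: le_less_trans)
      then show ?thesis
        by simp
    qed (use assms in auto)
  qed
  have "level_set u \<alpha> \<in> hyperspace" if "\<alpha> \<in> {0..1}" for \<alpha>
  proof -
    have "closed (level_set u \<alpha>)"
      using cl by (simp add: level_set_def)
    then have "compact (level_set u \<alpha>)"
      using compact_Int_closed [OF X] by auto
    moreover have "x1 \<in> level_set u \<alpha>"
      using that x1 closure_subset [of "{x. 0 < u x}"] by (auto simp: level_set_def)
    ultimately show ?thesis
      by (auto simp: hyperspace_def)
  qed
  then show ?thesis
    using u cl by (simp add: fuzzy_space_def upper_semicontinuous_iff_closed)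
qed

lemma fuzzy_space_attains_1:
  assumes "u \<in> fuzzy_space"
  obtains x where "u x = 1"
proof -
  have "level_set u 1 \<noteq> {}" and "\<And>x. u x \<le> 1"
    using assms by (auto simp: fuzzy_space_def hyperspace_def)
  then show thesis
    using that by (force simp: level_set_def intro: antisym)
qed

lemma level_set_fuzzy_map:
  fixes h :: "'a::metric_space \<Rightarrow> 'a"
  assumes "compact (UNIV :: 'a set)" "continuous_on UNIV h" "u \<in> fuzzy_space" "0 < \<alpha>"
  shows "level_set (fuzzy_map h u) \<alpha> = h ` level_set u \<alpha>"
  using push_sup_superlevel [of h u \<alpha>] assms
  by (simp add: level_set_def fuzzy_map_eq_push_sup fuzzy_space_def)

text \<open>The diameter of the compact space bounds the family of level distances, so its supremum
  dominates each member. Asking for nonempty levels instead of membership in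
  \<open>fuzzy_space\<close> lets this apply to images under \<open>fuzzy_map\<close>
  directly.\<close>

lemma hausdorff_dist_level_set_le_fuzzy_dist:
  fixes u v :: "'a::metric_space \<Rightarrow> real"
  assumes X: "compact (UNIV :: 'a set)"
    and ne: "\<And>\<alpha>. \<alpha> \<in> {0<..1} \<Longrightarrow> level_set u \<alpha> \<noteq> {} \<and> level_set v \<alpha> \<noteq> {}"
    and "\<alpha> \<in> {0<..1}"
  shows "hausdorff_dist (level_set u \<alpha>) (level_set v \<alpha>) \<le> fuzzy_dist u v"
  unfolding fuzzy_dist_def
proof (rule cSUP_upper)
  obtain M where M: "\<And>x y :: 'a. dist x y \<le> M"
    using compact_imp_bounded [OF X] by (auto simp: bounded_two_points)
  show "bdd_above ((\<lambda>\<alpha>. hausdorff_dist (level_set u \<alpha>) (level_set v \<alpha>)) ` {0<..1})"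
    using ne M by (intro bdd_aboveI2 [where M = M] hausdorff_dist_le) (simp_all add: ex_in_conv bex_simps)
qed (use assms in auto)

section \<open>Chain mixing\<close>

lemma chain_mixing_uniform:
  fixes f :: "nat \<Rightarrow> 'a::metric_space \<Rightarrow> 'a"
  assumes X: "compact (UNIV :: 'a set)" and f: "equicontinuous_seq f"
    and mix: "chain_mixing UNIV dist f" and "0 < e"
  obtains N where "1 \<le> N" "\<And>n x y. N \<le> n \<Longrightarrow> \<exists>c. is_chain UNIV dist f e n x y c"
proof -
  \<comment> \<open>Up to three errors meet in one step: moving the start, the chain itself, and
    moving the end. All three occur when \<open>n = 1\<close>.\<close>
  define e' where "e' = e / 3"
  have "0 < e'"
    using \<open>0 < e\<close> by (simp add: e'_def)
  then obtain d where d: "0 < d" "\<And>n x y. dist x y < d \<Longrightarrow> dist (f n x) (f n y) < e'"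
    using f unfolding equicontinuous_seq_def by meson
  \<comment> \<open>Radius \<open>d\<close> controls a moved start after applying the map, radius
    \<open>e'\<close> a moved end.\<close>
  have "0 < min d e'"
    using d \<open>0 < e'\<close> by simp
  then obtain F where F: "finite F" "(UNIV :: 'a set) \<subseteq> (\<Union>x\<in>F. ball x (min d e'))"
    using X unfolding compact_eq_totally_bounded by blast
  have "\<forall>x y. \<exists>N\<ge>1. \<forall>n\<ge>N. \<exists>c. is_chain UNIV dist f e' n x y c"
    using mix \<open>0 < e'\<close> by (simp add: chain_mixing_def)
  then obtain N where N: "\<And>x y n. N x y \<le> n \<Longrightarrow> \<exists>c. is_chain UNIV dist f e' n x y c"
    by metis
  define M where "M = Max (insert 1 ((\<lambda>(x, y). N x y) ` (F \<times> F)))"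
  show thesis
  proof (rule that)
    show "1 \<le> M"
      using F(1) by (simp add: M_def)
    fix n x y assume "M \<le> n"
    obtain x' where x': "x' \<in> F" "dist x' x < min d e'"
      using F(2) by (auto simp: subset_iff)
    obtain y' where y': "y' \<in> F" "dist y' y < min d e'"
      using F(2) by (auto simp: subset_iff)
    have "N x' y' \<le> M"
      using F(1) x' y' by (auto simp: M_def intro!: Max_ge)
    then obtain c where c: "is_chain UNIV dist f e' n x' y' c"
      using N \<open>M \<le> n\<close> by (meson order_trans)
    have "1 \<le> n"
      using \<open>1 \<le> M\<close> \<open>M \<le> n\<close> by simp
    \<comment> \<open>A chain between net points, with its two ends replaced. Since \<open>n\<close>
      is at least 1, the second update does not overwrite the first.\<close>
    define b where "b = c(0 := x, n := y)"
    have "dist (f i (b i)) (b (Suc i)) < e" if "i < n" for i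
    proof -
      have "dist (f i (b i)) (f i (c i)) < e'"
        using that x' c d(2) \<open>0 < e'\<close> by (auto simp: b_def is_chain_def dist_commute)
      moreover have "dist (f i (c i)) (c (Suc i)) < e'"
        using c that by (simp add: is_chain_def)
      moreover have "dist (c (Suc i)) (b (Suc i)) < e'"
        using that y' c \<open>0 < e'\<close> by (auto simp: b_def is_chain_def)
      ultimately show ?thesis
        using dist_triangle [of "f i (b i)" "b (Suc i)" "f i (c i)"]
          dist_triangle [of "f i (c i)" "b (Suc i)" "c (Suc i)"]
        by (simp add: e'_def)
    qed
    then have "is_chain UNIV dist f e n x y b"
      using \<open>1 \<le> n\<close> by (simp add: is_chain_def b_def)
    then show "\<exists>c. is_chain UNIV dist f e n x y c"
      by blast
  qed
qed

section \<open>From chains of sets to chains of points\<close>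

lemma chain_mixing_of_hyperspace:
  fixes f :: "nat \<Rightarrow> 'a::metric_space \<Rightarrow> 'a"
  assumes cont: "\<And>n. continuous_on UNIV (f n)"
    and mix: "chain_mixing hyperspace hausdorff_dist (\<lambda>n. induced_map (f n))"
  shows "chain_mixing UNIV dist f"
  unfolding chain_mixing_def
proof (intro allI impI ballI)
  fix e :: real and x y :: 'a
  assume "0 < e"
  moreover have "{x} \<in> hyperspace" "{y} \<in> hyperspace"
    by (auto simp: hyperspace_def)
  ultimately obtain N where "1 \<le> N" and N: "\<And>n. N \<le> n \<Longrightarrow>
      \<exists>c. is_chain hyperspace hausdorff_dist (\<lambda>n. induced_map (f n)) e n {x} {y} c"
    using mix unfolding chain_mixing_def by meson
  have "\<exists>c. is_chain UNIV dist f e n x y c" if n: "N \<le> n" for n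
  proof -
    obtain A where A: "\<And>i. i \<le> n \<Longrightarrow> A i \<in> hyperspace" "A 0 = {x}" "A n = {y}"
      "\<And>i. i < n \<Longrightarrow> hausdorff_dist (f i ` A i) (A (Suc i)) < e"
      using N [OF n] by (auto simp: is_chain_def induced_map_def)
    have step: "\<exists>a\<in>A i. dist (f i a) b < e" if "i < n" "b \<in> A (Suc i)" for i b
    proof -
      have "f i ` A i \<in> hyperspace"
        using A(1) [of i] that cont
        by (auto simp: hyperspace_def intro!: compact_continuous_image intro: continuous_on_subset)
      then show ?thesis
        using hausdorff_dist_less_imp_near [OF _ A(1) A(4) that(2)] that(1) by auto
    qed
    \<comment> \<open>Induction on the length \<open>k\<close> of the final segment:
      \<open>c\<close> is indexed from 0, while sets and maps keep their original time
      \<open>n - k + i\<close>.\<close>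
    have "\<exists>c. (\<forall>i\<le>k. c i \<in> A (n - k + i)) \<and> c k = y
        \<and> (\<forall>i<k. dist (f (n - k + i) (c i)) (c (Suc i)) < e)" if "k \<le> n" for k
      using that
    proof (induction k)
      case 0
      show ?case
        using A(3) by (intro exI [of _ "\<lambda>_. y"]) auto
    next
      case (Suc k)
      then obtain c where c: "\<forall>i\<le>k. c i \<in> A (n - k + i)" "c k = y"
        "\<forall>i<k. dist (f (n - k + i) (c i)) (c (Suc i)) < e"
        by auto
      have nk: "n - k = Suc (n - Suc k)"
        using Suc.prems by simp
      then have "c 0 \<in> A (Suc (n - Suc k))"
        using c(1) by fastforce
      then obtain a where a: "a \<in> A (n - Suc k)" "dist (f (n - Suc k) a) (c 0) < e"
        using step [of "n - Suc k" "c 0"] Suc.prems by auto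
      have idx: "n - Suc k + Suc j = n - k + j" for j
        using nk by simp
      \<comment> \<open>Prepends \<open>a\<close> and shifts \<open>c\<close> by one.\<close>
      let ?c = "case_nat a c"
      have "?c i \<in> A (n - Suc k + i)" if "i \<le> Suc k" for i
        using that a c(1) by (cases i) (simp_all del: add_Suc_right diff_Suc_Suc add: idx)
      moreover have "dist (f (n - Suc k + i) (?c i)) (?c (Suc i)) < e" if "i < Suc k" for i
        using that a c(3) by (cases i) (simp_all del: add_Suc_right diff_Suc_Suc add: idx)
      ultimately show ?case
        using c(2) by (intro exI [of _ ?c]) simp
    qed
    \<comment> \<open>At \<open>k = n\<close> the time offset vanishes, and \<open>A 0 = {x}\<close>
      forces the chain to start at \<open>x\<close>.\<close>
    from this [of n] obtain c where "\<forall>i\<le>n. c i \<in> A i" "c n = y"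
        "\<forall>i<n. dist (f i (c i)) (c (Suc i)) < e"
      by auto
    then have "is_chain UNIV dist f e n x y c"
      using A(2) by (auto simp: is_chain_def)
    then show ?thesis
      by blast
  qed
  with \<open>1 \<le> N\<close> show "\<exists>N\<ge>1. \<forall>n\<ge>N. \<exists>c. is_chain UNIV dist f e n x y c"
    by blast
qed

section \<open>From chains of fuzzy sets to chains of sets\<close>

lemma chain_mixing_hyperspace_of_fuzzy_space:
  fixes f :: "nat \<Rightarrow> 'a::metric_space \<Rightarrow> 'a"
  assumes X: "compact (UNIV :: 'a set)" and cont: "\<And>n. continuous_on UNIV (f n)"
    and mix: "chain_mixing fuzzy_space fuzzy_dist (\<lambda>n. fuzzy_map (f n))"
  shows "chain_mixing hyperspace hausdorff_dist (\<lambda>n. induced_map (f n))"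
  unfolding chain_mixing_def
proof (intro allI impI ballI)
  fix e :: real and A B :: "'a set"
  assume "0 < e" and A: "A \<in> hyperspace" and B: "B \<in> hyperspace"
  \<comment> \<open>Every level set of the indicator of \<open>C\<close> at a height in (0,1] is
    \<open>C\<close> itself.\<close>
  have ind: "indicat_real C \<in> fuzzy_space" and ind1: "level_set (indicat_real C) 1 = C"
    if C: "C \<in> hyperspace" for C :: "'a set"
  proof -
    obtain x where "x \<in> C"
      using C by (auto simp: hyperspace_def)
    moreover have "{x. \<alpha> \<le> indicat_real C x} = C" if "0 < \<alpha>" "\<alpha> \<le> 1" for \<alpha>
      using that by (auto simp: indicator_def split: if_splits)
    ultimately show "indicat_real C \<in> fuzzy_space" "level_set (indicat_real C) 1 = C"
      using C by (auto simp: hyperspace_def level_set_def compact_imp_closed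
          intro!: fuzzy_spaceI [OF X, of _ x] split: split_indicator)
  qed
  obtain N where "1 \<le> N" and N: "\<And>n. N \<le> n \<Longrightarrow> \<exists>c. is_chain fuzzy_space fuzzy_dist
      (\<lambda>n. fuzzy_map (f n)) e n (indicat_real A) (indicat_real B) c"
    using mix ind [OF A] ind [OF B] \<open>0 < e\<close> unfolding chain_mixing_def by meson
  have "\<exists>c. is_chain hyperspace hausdorff_dist (\<lambda>n. induced_map (f n)) e n A B c"
    if n: "N \<le> n" for n
  proof -
    obtain c where c: "is_chain fuzzy_space fuzzy_dist (\<lambda>n. fuzzy_map (f n)) e n
        (indicat_real A) (indicat_real B) c"
      using N [OF n] by blast
    have mem: "level_set (c i) \<alpha> \<in> hyperspace" if "i \<le> n" "\<alpha> \<in> {0..1}" for i \<alpha>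
      using c that by (auto simp: is_chain_def fuzzy_space_def)
    have "hausdorff_dist (f i ` level_set (c i) 1) (level_set (c (Suc i)) 1) < e" if "i < n" for i
    proof -
      have ci: "c i \<in> fuzzy_space"
        using c that by (simp add: is_chain_def)
      have "level_set (fuzzy_map (f i) (c i)) \<alpha> \<noteq> {} \<and> level_set (c (Suc i)) \<alpha> \<noteq> {}"
        if "\<alpha> \<in> {0<..1}" for \<alpha>
        using level_set_fuzzy_map [OF X cont ci] mem [of i \<alpha>] mem [of "Suc i" \<alpha>] that \<open>i < n\<close>
        by (auto simp: hyperspace_def)
      from hausdorff_dist_level_set_le_fuzzy_dist [OF X this, of 1]
      have "hausdorff_dist (f i ` level_set (c i) 1) (level_set (c (Suc i)) 1)
          \<le> fuzzy_dist (fuzzy_map (f i) (c i)) (c (Suc i))"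
        using level_set_fuzzy_map [OF X cont ci] by simp
      also have "\<dots> < e"
        using c that by (simp add: is_chain_def)
      finally show ?thesis .
    qed
    then have "is_chain hyperspace hausdorff_dist (\<lambda>n. induced_map (f n)) e n A B
        (\<lambda>i. level_set (c i) 1)"
      using c mem ind1 [OF A] ind1 [OF B] by (simp add: is_chain_def induced_map_def)
    then show ?thesis
      by blast
  qed
  with \<open>1 \<le> N\<close> show "\<exists>N\<ge>1. \<forall>n\<ge>N. \<exists>c.
      is_chain hyperspace hausdorff_dist (\<lambda>n. induced_map (f n)) e n A B c"
    by blast
qed

section \<open>From chains of points to chains of fuzzy sets\<close>

lemma compact_UNIV_fun:
  assumes "compact (UNIV :: 'a::topological_space set)"
  shows "compact (UNIV :: ('i \<Rightarrow> 'a) set)"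
proof -
  \<comment> \<open>Tychonoff's theorem for the abstract product topology, which is then identified
    with the topology of the function type.\<close>
  have "compact_space (product_topology (\<lambda>i::'i. euclidean :: 'a topology) UNIV)"
    unfolding compact_space_product_topology using assms by (simp add: compact_space_def)
  then have "compact_space (euclidean :: ('i \<Rightarrow> 'a) topology)"
    by (simp only: euclidean_product_topology)
  then show ?thesis
    by (simp add: compact_space_def)
qed

text \<open>Two radii are used: the bound \<open>\<le> e\<close> defines a closed set of sequences
  and survives the suprema in both distances, and \<open>e < e'\<close> restores the strict
  inequality of \<open>is_chain\<close>.\<close>

lemma chain_of_fuzzy_sets:
  fixes f :: "nat \<Rightarrow> 'a::metric_space \<Rightarrow> 'a"
  assumes X: "compact (UNIV :: 'a set)" and cont: "\<And>n. continuous_on UNIV (f n)"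
    and u: "u \<in> fuzzy_space" and v: "v \<in> fuzzy_space" and "e < e'"
    and ex: "\<And>x y. \<exists>c. is_chain UNIV dist f e n x y c"
  shows "\<exists>c. is_chain fuzzy_space fuzzy_dist (\<lambda>n. fuzzy_map (f n)) e' n u v c"
proof -
  \<comment> \<open>Infinite sequences constrained only in their first \<open>n\<close> steps, so
    that \<open>P\<close> sits inside a compact product.\<close>
  define P where "P = {c. \<forall>i<n. dist (f i (c i)) (c (Suc i)) \<le> e}"
  \<comment> \<open>The value 0 off \<open>P\<close> confines every positive superlevel set of
    \<open>w\<close> to the closed set \<open>P\<close>.\<close>
  define w where "w c = (if c \<in> P then min (u (c 0)) (v (c n)) else 0)" for c :: "nat \<Rightarrow> 'a"
  define U where "U k = push_sup (\<lambda>c. c k) w" for k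
  have u01: "0 \<le> u x" "u x \<le> 1" and v01: "0 \<le> v x" "v x \<le> 1" for x
    using u v by (auto simp: fuzzy_space_def)
  have ucl: "closed {x. \<alpha> \<le> u x}" and vcl: "closed {x. \<alpha> \<le> v x}" for \<alpha>
    using u v by (auto simp: fuzzy_space_def upper_semicontinuous_iff_closed)
  have Pex: "\<exists>c\<in>P. c 0 = x \<and> c n = y" for x y
    using ex [of x y] by (force simp: is_chain_def P_def)
  have eval: "continuous_on UNIV (\<lambda>c :: nat \<Rightarrow> 'a. c k)" for k
    by (rule continuous_on_product_coordinates)
  have feval: "continuous_on UNIV (\<lambda>c :: nat \<Rightarrow> 'a. f i (c k))" for i k
    using continuous_on_compose2 [OF cont eval] by auto
  have Y: "compact (UNIV :: (nat \<Rightarrow> 'a) set)"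
    using X by (rule compact_UNIV_fun)
  have "closed P"
    unfolding P_def
    by (intro closed_Collect_all closed_Collect_imp open_Collect_const closed_Collect_le
        continuous_on_dist continuous_on_const feval eval)
  have wlevel: "{c. \<alpha> \<le> w c} = P \<inter> (\<lambda>c. c 0) -` {x. \<alpha> \<le> u x} \<inter> (\<lambda>c. c n) -` {x. \<alpha> \<le> v x}"
    if "0 < \<alpha>" for \<alpha>
    using that by (auto simp: w_def)
  have w0: "0 \<le> w c" for c
    using u01 v01 by (simp add: w_def)
  have wusc: "upper_semicontinuous w"
    unfolding upper_semicontinuous_iff_closed
  proof
    fix \<alpha> :: real
    show "closed {c. \<alpha> \<le> w c}"
    proof (cases "0 < \<alpha>")
      case True
      show ?thesis
        unfolding wlevel [OF True]
        using \<open>closed P\<close> ucl vcl eval by (intro closed_Int closed_vimage) auto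
    next
      case False
      then have "{c. \<alpha> \<le> w c} = UNIV"
        using w0 by (auto simp: not_less intro: order_trans)
      then show ?thesis
        by simp
    qed
  qed
  have Ulevel: "{x. \<alpha> \<le> U k x} = (\<lambda>c. c k) ` {c. \<alpha> \<le> w c}" if "0 < \<alpha>" for \<alpha> k
    unfolding U_def using push_sup_superlevel [OF Y eval wusc that] .
  \<comment> \<open>Constant sequences make each evaluation surjective, so the default value of
    \<open>push_sup\<close> never occurs.\<close>
  have fibre: "(\<lambda>c :: nat \<Rightarrow> 'a. c k) -` {x} \<noteq> {}" for k x
  proof -
    have "(\<lambda>_. x) \<in> (\<lambda>c :: nat \<Rightarrow> 'a. c k) -` {x}"
      by simp
    then show ?thesis
      by (metis empty_iff)
  qed
  have Uex: "\<exists>c. c k = x \<and> U k x = w c \<and> (\<forall>c'. c' k = x \<longrightarrow> w c' \<le> w c)" for k x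
    using push_sup_attained [OF Y eval wusc fibre, of k x] unfolding U_def by metis
  obtain x1 y1 where x1: "u x1 = 1" and y1: "v y1 = 1"
    using fuzzy_space_attains_1 u v by metis
  have w1: "\<exists>c. w c = 1"
  proof -
    obtain c where "c \<in> P" "c 0 = x1" "c n = y1"
      using Pex by blast
    then have "w c = 1"
      using x1 y1 by (simp add: w_def)
    then show ?thesis
      by (rule exI [of _ c])
  qed
  have wle: "w c \<le> u (c 0)" "w c \<le> v (c n)" for c
    using u01 v01 by (auto simp: w_def)
  have U0: "U 0 = u"
  proof
    fix x
    obtain c where c: "c 0 = x" "U 0 x = w c" "\<forall>c'. c' 0 = x \<longrightarrow> w c' \<le> w c"
      using Uex [of 0 x] by auto
    \<comment> \<open>A chain from \<open>x\<close> to a point where \<open>v\<close> is 1 has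
      weight exactly \<open>u x\<close>, which gives the lower bound. This works for each
      \<open>x\<close> because \<open>ex\<close> covers all pairs of end points.\<close>
    obtain c' where c': "c' \<in> P" "c' 0 = x" "c' n = y1"
      using Pex [of x y1] by auto
    then have "w c' = u x"
      using y1 u01 by (simp add: w_def)
    then show "U 0 x = u x"
      using c c' wle(1) [of c] by fastforce
  qed
  have Un: "U n = v"
  proof
    fix y
    obtain c where c: "c n = y" "U n y = w c" "\<forall>c'. c' n = y \<longrightarrow> w c' \<le> w c"
      using Uex [of n y] by auto
    obtain c' where c': "c' \<in> P" "c' 0 = x1" "c' n = y"
      using Pex [of x1 y] by auto
    then have "w c' = v y"
      using x1 v01 by (simp add: w_def)
    then show "U n y = v y"
      using c c' wle(2) [of c] by fastforce
  qed
  have UF: "U k \<in> fuzzy_space" for k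
  proof -
    obtain c1 where "w c1 = 1"
      using w1 by auto
    have "w c \<le> 1" for c
      using wle(1) u01(2) by (rule order_trans)
    then have U01: "0 \<le> U k x" "U k x \<le> 1" for x
      using Uex [of k x] w0 by auto
    have "closed {x. \<alpha> \<le> U k x}" if "0 < \<alpha>" for \<alpha>
    proof -
      have "compact {c. \<alpha> \<le> w c}"
        using wusc compact_Int_closed [OF Y, of "{c. \<alpha> \<le> w c}"]
        by (simp add: upper_semicontinuous_iff_closed)
      then have "compact ((\<lambda>c. c k) ` {c. \<alpha> \<le> w c})"
        by (intro compact_continuous_image continuous_on_subset [OF eval]) auto
      then show ?thesis
        unfolding Ulevel [OF that] by (rule compact_imp_closed)
    qed
    moreover have "U k (c1 k) = 1"
    proof -
      have "c1 k \<in> {x. 1 \<le> U k x}"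
        unfolding Ulevel [of 1, simplified] using \<open>w c1 = 1\<close> by auto
      then show ?thesis
        using U01 by (simp add: antisym)
    qed
    ultimately show ?thesis
      using U01 by (intro fuzzy_spaceI [OF X]) auto
  qed
  have "fuzzy_dist (fuzzy_map (f i) (U i)) (U (Suc i)) < e'" if "i < n" for i
  proof -
    have "fuzzy_dist (fuzzy_map (f i) (U i)) (U (Suc i)) \<le> e"
      unfolding fuzzy_dist_def
    proof (rule cSUP_least)
      \<comment> \<open>Both level sets are images of the same set \<open>?W\<close> of chains, so
        each chain pairs a point of one with a point of the other.\<close>
      fix \<alpha> :: real assume \<alpha>: "\<alpha> \<in> {0<..1}"
      let ?W = "{c. \<alpha> \<le> w c}"
      have fUi: "level_set (fuzzy_map (f i) (U i)) \<alpha> = (\<lambda>c. f i (c i)) ` ?W"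
        using level_set_fuzzy_map [OF X cont UF] Ulevel \<alpha> by (simp add: level_set_def image_image)
      have USuc: "level_set (U (Suc i)) \<alpha> = (\<lambda>c. c (Suc i)) ` ?W"
        using Ulevel \<alpha> by (simp add: level_set_def)
      obtain c1 where "w c1 = 1"
        using w1 by (rule exE)
      with \<alpha> have "c1 \<in> ?W"
        by simp
      have step: "dist (f i (c i)) (c (Suc i)) \<le> e" if "c \<in> ?W" for c
      proof -
        have "c \<in> P"
          using that \<alpha> by (cases "c \<in> P") (simp_all add: w_def)
        then show ?thesis
          using \<open>i < n\<close> by (simp add: P_def)
      qed
      show "hausdorff_dist (level_set (fuzzy_map (f i) (U i)) \<alpha>) (level_set (U (Suc i)) \<alpha>) \<le> e"
        unfolding fUi USuc
      proof (rule hausdorff_dist_le)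
        fix a assume "a \<in> (\<lambda>c. f i (c i)) ` ?W"
        then obtain c where "a = f i (c i)" "c \<in> ?W"
          by (rule imageE)
        then show "\<exists>b\<in>(\<lambda>c. c (Suc i)) ` ?W. dist a b \<le> e"
          using step by (intro bexI [of _ "c (Suc i)"] imageI) simp_all
      next
        fix b assume "b \<in> (\<lambda>c. c (Suc i)) ` ?W"
        then obtain c where "b = c (Suc i)" "c \<in> ?W"
          by (rule imageE)
        then show "\<exists>a\<in>(\<lambda>c. f i (c i)) ` ?W. dist a b \<le> e"
          using step by (intro bexI [of _ "f i (c i)"] image_eqI [of _ _ c]) simp_all
      qed (use \<open>c1 \<in> ?W\<close> in blast)+
    qed auto
    with \<open>e < e'\<close> show ?thesis
      by simp
  qed
  then have "is_chain fuzzy_space fuzzy_dist (\<lambda>n. fuzzy_map (f n)) e' n u v U"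
    using UF U0 Un by (simp add: is_chain_def)
  then show ?thesis
    by (rule exI [of _ U])
qed

lemma chain_mixing_fuzzy_space:
  fixes f :: "nat \<Rightarrow> 'a::metric_space \<Rightarrow> 'a"
  assumes X: "compact (UNIV :: 'a set)" and cont: "\<And>n. continuous_on UNIV (f n)"
    and "equicontinuous_seq f" "chain_mixing UNIV dist f"
  shows "chain_mixing fuzzy_space fuzzy_dist (\<lambda>n. fuzzy_map (f n))"
  unfolding chain_mixing_def
proof (intro allI impI ballI)
  fix e :: real and u v :: "'a \<Rightarrow> real"
  assume "0 < e" and u: "u \<in> fuzzy_space" and v: "v \<in> fuzzy_space"
  \<comment> \<open>Halving leaves the gap between the two radii. The resulting \<open>N\<close>
    depends on neither end point, so it serves all points of \<open>u\<close> and \<open>v\<close>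
    at once.\<close>
  then have "0 < e / 2" "e / 2 < e"
    by auto
  obtain N where "1 \<le> N" "\<And>n x y. N \<le> n \<Longrightarrow> \<exists>c. is_chain UNIV dist f (e / 2) n x y c"
    using chain_mixing_uniform [OF X assms(3,4) \<open>0 < e / 2\<close>] by blast
  then show "\<exists>N\<ge>1. \<forall>n\<ge>N. \<exists>c. is_chain fuzzy_space fuzzy_dist (\<lambda>n. fuzzy_map (f n)) e n u v c"
    by (intro exI [of _ N] conjI allI impI chain_of_fuzzy_sets [OF X cont u v \<open>e / 2 < e\<close>]) auto
qed

theorem theorem3p4:
  fixes f :: "nat \<Rightarrow> 'a::metric_space \<Rightarrow> 'a"
  assumes "compact (UNIV :: 'a set)"
    and "\<And>n. continuous_on UNIV (f n)"
    and "equicontinuous_seq f"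
  shows "(chain_mixing (UNIV :: 'a set) dist f \<longleftrightarrow>
            chain_mixing (hyperspace :: 'a set set) hausdorff_dist (\<lambda>n. induced_map (f n))) \<and>
         (chain_mixing (hyperspace :: 'a set set) hausdorff_dist (\<lambda>n. induced_map (f n)) \<longleftrightarrow>
            chain_mixing (fuzzy_space :: ('a \<Rightarrow> real) set) fuzzy_dist (\<lambda>n. fuzzy_map (f n)))"
  using chain_mixing_of_hyperspace [of f, OF assms(2)] chain_mixing_fuzzy_space [of f, OF assms]
    chain_mixing_hyperspace_of_fuzzy_space [of f, OF assms(1,2)]
  by blast

end
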